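(* Let $\Gamma$ be a finite simple graph with vertex set $V=\{1,\dots,n\}$ and edge set $E_\Gamma$, and suppose $X=\{1,\dots,m\}$ is a clique in $\Gamma$. Let $N=\langle\langle a_{ij}\mid \{i,j\}\in\binom{V}{2}\setminus E_\Gamma\rangle\rangle$ be the normal closure in $P_n$. Then there is a split extension $$1\longrightarrow P_{n,m}/N\longrightarrow P_\Gamma\longrightarrow P_m\longrightarrow 1.$$
   Context: $B_n$ is the Artin braid group on $n$ strands with standard generators $\sigma_1,\dots,\sigma_{n-1}$, and $P_n\subseteq B_n$ is the pure braid group, generated by $a_{ij}=\sigma_{j-1}\cdots\sigma_{i+1}\sigma_i^2\sigma_{i+1}^{-1}\cdots\sigma_{j-1}^{-1}$, $1\le i<j\le n$. For $m\le n$, $P_{n,m}=\ker(P_n\to P_m)$, where $P_n\to P_m$ forgets the last $n-m$ strands. A clique is a subset $X\subseteq V$ with $\binom{X}{2}\subseteq E_\Gamma$. The graphic pure braid group is $P_\Gamma=P_n/N$. (Since $X$ is a clique, $N\subseteq P_{n,m}$.) *)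

theory Defs
  imports
    "HOL-Library.Ramsey"
    "HOL-Algebra.Algebra"
begin

section \<open>The Artin braid group\<close>

text \<open>
  The letter \<open>(i, True)\<close> is the generator \<open>\<sigma>\<^sub>i\<close>, the letter \<open>(i, False)\<close> its inverse.
\<close>

type_synonym braid_word = "(nat \<times> bool) list"

definition braid_words :: "nat \<Rightarrow> braid_word set"
  where "braid_words n = lists ({i. 1 \<le> i \<and> i < n} \<times> UNIV)"

text \<open>
  All words occurring in a derivation are words in \<open>\<sigma>\<^sub>1, \<dots>, \<sigma>\<^sub>n\<^sub>-\<^sub>1\<close>, so this is
  equality in the group presented by these \<open>n - 1\<close> generators and Artin's relations.
\<close>

inductive braid_eq :: "nat \<Rightarrow> braid_word \<Rightarrow> braid_word \<Rightarrow> bool" for n :: nat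
  where
    refl: "w \<in> braid_words n \<Longrightarrow> braid_eq n w w"
  | sym: "braid_eq n v w \<Longrightarrow> braid_eq n w v"
  | trans: "braid_eq n u v \<Longrightarrow> braid_eq n v w \<Longrightarrow> braid_eq n u w"
  | cong: "x \<in> braid_words n \<Longrightarrow> y \<in> braid_words n \<Longrightarrow> braid_eq n v w
      \<Longrightarrow> braid_eq n (x @ v @ y) (x @ w @ y)"
  | cancel: "1 \<le> i \<Longrightarrow> i < n \<Longrightarrow> braid_eq n [(i, b), (i, \<not> b)] []"
  | far: "1 \<le> i \<Longrightarrow> i + 1 < j \<Longrightarrow> j < n
      \<Longrightarrow> braid_eq n [(i, True), (j, True)] [(j, True), (i, True)]"
  | braid: "1 \<le> i \<Longrightarrow> i + 1 < n
      \<Longrightarrow> braid_eq n [(i, True), (i + 1, True), (i, True)] [(i + 1, True), (i, True), (i + 1, True)]"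

definition braid_rel :: "nat \<Rightarrow> (braid_word \<times> braid_word) set"
  where "braid_rel n = {(v, w). braid_eq n v w}"

definition braid_group :: "nat \<Rightarrow> braid_word set monoid"
  where "braid_group n =
    \<lparr> carrier = braid_words n // braid_rel n,
      monoid.mult = (\<lambda>A B. braid_rel n `` {v @ w | v w. v \<in> A \<and> w \<in> B}),
      one = braid_rel n `` {[]} \<rparr>"

section \<open>Pure braids\<close>

text \<open>
  A word is read from left to right. If initially strand \<open>p k\<close> sits in position \<open>k\<close>,
  then after the word \<open>w\<close> strand \<open>(p \<circ> braid_perm w) k\<close> sits there.
\<close>

fun braid_perm :: "braid_word \<Rightarrow> nat \<Rightarrow> nat"
  where
    "braid_perm [] = id"
  | "braid_perm ((i, b) # w) = transpose i (i + 1) \<circ> braid_perm w"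

text \<open>
  Here and below, a function that is constant on a class \<open>A\<close> of words (or on a coset) is
  evaluated on it as \<open>the_elem (f ` A)\<close>.
\<close>

definition pure_braid_group :: "nat \<Rightarrow> braid_word set monoid"
  where "pure_braid_group n = (braid_group n)
    \<lparr> carrier := kernel (braid_group n) (sym_group n) (\<lambda>A. the_elem (braid_perm ` A)) \<rparr>"

definition pure_gen :: "nat \<Rightarrow> nat \<Rightarrow> nat \<Rightarrow> braid_word set"
  where "pure_gen n i j = braid_rel n ``
    {map (\<lambda>k. (k, True)) (rev [i + 1..<j]) @ [(i, True), (i, True)]
      @ map (\<lambda>k. (k, False)) [i + 1..<j]}"

section \<open>Forgetting strands\<close>

text \<open>
  \<open>forget_word m p w\<close> erases the strands with label greater than \<open>m\<close> from the braid diagram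
  \<open>w\<close>, where \<open>p k\<close> is the label of the strand that is in position \<open>k\<close> before \<open>w\<close>. A crossing
  survives iff both strands involved do, and its new index is the number of surviving strands
  in positions \<open>1, \<dots>, i\<close>.
\<close>

fun forget_word :: "nat \<Rightarrow> (nat \<Rightarrow> nat) \<Rightarrow> braid_word \<Rightarrow> braid_word"
  where
    "forget_word m p [] = []"
  | "forget_word m p ((i, b) # w) =
      (if p i \<le> m \<and> p (i + 1) \<le> m then [(card {k \<in> {1..i}. p k \<le> m}, b)] else [])
      @ forget_word m (p \<circ> transpose i (i + 1)) w"

text \<open>
  This is the forgetful homomorphism from \<open>P\<^sub>n\<close> to \<open>P\<^sub>m\<close> for every \<open>n \<ge> m\<close>.
\<close>

definition forget :: "nat \<Rightarrow> braid_word set \<Rightarrow> braid_word set"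
  where "forget m A = braid_rel m `` (forget_word m id ` A)"

definition pure_braid_forget_kernel :: "nat \<Rightarrow> nat \<Rightarrow> braid_word set monoid"
  where "pure_braid_forget_kernel n m = (pure_braid_group n)
    \<lparr> carrier := kernel (pure_braid_group n) (pure_braid_group m) (forget m) \<rparr>"

section \<open>Graphic pure braid groups\<close>

definition normal_closure :: "('a, 'b) monoid_scheme \<Rightarrow> 'a set \<Rightarrow> 'a set"
  where "normal_closure G S = \<Inter> {H. H \<lhd> G \<and> S \<subseteq> H}"

text \<open>
  The graph on \<open>{1, \<dots>, n}\<close> is given by its edge set \<open>E\<close>, a set of two-element subsets.
\<close>

definition graphic_relators :: "nat \<Rightarrow> nat set set \<Rightarrow> braid_word set set"
  where "graphic_relators n E = normal_closure (pure_braid_group n)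
    {pure_gen n i j | i j. i < j \<and> {i, j} \<in> [{1..n}]\<^bsup>2\<^esup> - E}"

definition graphic_pure_braid_group :: "nat \<Rightarrow> nat set set \<Rightarrow> braid_word set set monoid"
  where "graphic_pure_braid_group n E = pure_braid_group n Mod graphic_relators n E"

section \<open>Split extensions\<close>

text \<open>
  The library's \<open>short_exact_sequence\<close> requires the three groups to have the same element type.
\<close>

definition split_extension ::
    "('a, 'x) monoid_scheme \<Rightarrow> ('a \<Rightarrow> 'b) \<Rightarrow> ('b, 'y) monoid_scheme \<Rightarrow> ('b \<Rightarrow> 'c)
      \<Rightarrow> ('c, 'z) monoid_scheme \<Rightarrow> bool"
  where "split_extension A f B g C \<longleftrightarrow>
    group A \<and> group B \<and> group C \<and>
    f \<in> mon A B \<and> g \<in> epi B C \<and> f ` carrier A = kernel B C g \<and>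
    (\<exists>s \<in> hom C B. \<forall>x \<in> carrier C. g (s x) = x)"

end

theory Submission
  imports Defs
begin

text \<open>
  The forgetful homomorphism \<open>P\<^sub>n \<rightarrow> P\<^sub>m\<close> has a section: a braid word on \<open>m\<close> strands is also a
  braid word on \<open>n\<close> strands, and erasing the \<open>n - m\<close> idle strands gives back the word
  (\<open>forget_include\<close>). If \<open>{i, j}\<close> is not an edge and \<open>i < j\<close>, then \<open>j > m\<close>, because
  \<open>{1, \<dots>, m}\<close> is a clique. In the word defining \<open>a\<^sub>i\<^sub>j\<close>, strand \<open>j\<close> travels to strand \<open>i\<close>, winds
  around it and travels back, so strand \<open>j\<close> takes part in every crossing; erasing it leaves no
  crossing, and \<open>a\<^sub>i\<^sub>j\<close> is forgotten (\<open>forget_pure_gen\<close>). Hence \<open>N\<close> lies in the kernel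
  \<open>P\<^sub>n\<^sub>,\<^sub>m\<close>, and a split epimorphism stays one when a normal subgroup inside its kernel is
  divided out (\<open>split_extension_quotient\<close>).

  Most of the work is in showing that forgetting strands is a homomorphism of pure braid groups.
  It is well defined because each defining relation becomes a relation of the same kind or an
  identity of words when strands are erased (\<open>forget_word_eq\<close>). It preserves
  purity because the permutation of the erased diagram is the original one with positions replaced
  by their ranks among the surviving strands (\<open>braid_perm_forget_word\<close>).
\<close>

section \<open>Quotients of split epimorphisms\<close>

lemma the_elem_image_coset:
  assumes "h \<in> hom G H" "group H" "subgroup N G" "N \<subseteq> kernel G H h" "x \<in> carrier G"
  shows "the_elem (h ` (N #>\<^bsub>G\<^esub> x)) = h x"
proof -
  interpret H: group H by fact
  have "h (y \<otimes>\<^bsub>G\<^esub> x) = h x" if "y \<in> N" for y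
    using assms(4) that hom_mult[OF assms(1) _ assms(5), of y] hom_in_carrier[OF assms(1,5)]
    by (auto simp: kernel_def)
  moreover have "h ` (N #>\<^bsub>G\<^esub> x) = (\<lambda>y. h (y \<otimes>\<^bsub>G\<^esub> x)) ` N"
    unfolding r_coset_def by blast
  ultimately have "h ` (N #>\<^bsub>G\<^esub> x) = (\<lambda>y. h x) ` N"
    by simp
  also have "\<dots> = {h x}"
    using subgroup.one_closed[OF assms(3)] by blast
  finally have "h ` (N #>\<^bsub>G\<^esub> x) = {h x}" .
  then show ?thesis by simp
qed

text \<open>
  The quotient of the kernel sits inside the quotient of the group as a set of the same cosets, so
  the first map is the identity on cosets; the section is the old one followed by the projection.
\<close>

lemma split_extension_quotient:
  assumes G: "group G" and H: "group H" and h: "h \<in> hom G H"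
    and s: "s \<in> hom H G" and hs: "\<And>y. y \<in> carrier H \<Longrightarrow> h (s y) = y"
    and N: "N \<lhd> G" and NK: "N \<subseteq> kernel G H h"
  defines "K \<equiv> G\<lparr>carrier := kernel G H h\<rparr>"
  shows "N \<lhd> K"
    and "split_extension (K Mod N) (\<lambda>C. C) (G Mod N) (\<lambda>C. the_elem (h ` C)) H"
proof -
  interpret G: group G by fact
  interpret H: group H by fact
  interpret gh: group_hom G H h by unfold_locales (rule h)
  interpret N: normal N G by fact
  show NK': "N \<lhd> K"
    unfolding K_def
    by (rule G.normal_restrict_supergroup[OF gh.subgroup_kernel N NK])
  have coset_K: "N #>\<^bsub>K\<^esub> x = N #>\<^bsub>G\<^esub> x" for x
    by (simp add: K_def r_coset_def)
  have carrier_KN: "carrier (K Mod N) = (\<lambda>x. N #>\<^bsub>G\<^esub> x) ` kernel G H h"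
    by (simp add: carrier_FactGroup coset_K) (simp add: K_def)
  have mult_KN: "monoid.mult (K Mod N) = monoid.mult (G Mod N)"
    by (simp add: K_def set_mult_def fun_eq_iff)
  have coset_value: "the_elem (h ` (N #>\<^bsub>G\<^esub> x)) = h x" if "x \<in> carrier G" for x
    by (rule the_elem_image_coset[OF h H N.subgroup_axioms NK that])
  have sub: "carrier (K Mod N) \<subseteq> carrier (G Mod N)"
    unfolding carrier_KN by (auto simp: carrier_FactGroup kernel_def)
  have "group (K Mod N)"
    by (rule normal.factorgroup_is_group[OF NK'])
  then interpret KN: group "K Mod N" .
  have "(\<lambda>C. C) \<in> mon (K Mod N) (G Mod N)"
    using sub mult_KN by (auto simp: mon_def hom_def)
  moreover have hom: "(\<lambda>C. the_elem (h ` C)) \<in> hom (G Mod N) H"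
  proof (rule homI)
    fix C D assume "C \<in> carrier (G Mod N)" "D \<in> carrier (G Mod N)"
    then obtain x y where xy: "x \<in> carrier G" "y \<in> carrier G" "C = N #>\<^bsub>G\<^esub> x" "D = N #>\<^bsub>G\<^esub> y"
      by (auto simp: carrier_FactGroup)
    then show "the_elem (h ` (C \<otimes>\<^bsub>G Mod N\<^esub> D)) = the_elem (h ` C) \<otimes>\<^bsub>H\<^esub> the_elem (h ` D)"
      by (simp add: N.rcos_sum coset_value)
  qed (auto simp: carrier_FactGroup coset_value)
  moreover have section_value: "the_elem (h ` (N #>\<^bsub>G\<^esub> s y)) = y" if "y \<in> carrier H" for y
    using that hom_in_carrier[OF s] by (simp add: coset_value hs)
  moreover have "(\<lambda>y. N #>\<^bsub>G\<^esub> s y) \<in> hom H (G Mod N)"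
    using hom_compose[OF s N.r_coset_hom_Mod] by (simp add: comp_def)
  moreover have "(\<lambda>C. the_elem (h ` C)) ` carrier (G Mod N) = carrier H"
  proof
    show "(\<lambda>C. the_elem (h ` C)) ` carrier (G Mod N) \<subseteq> carrier H"
      using hom by (auto simp: hom_def)
    show "carrier H \<subseteq> (\<lambda>C. the_elem (h ` C)) ` carrier (G Mod N)"
    proof
      fix y assume y: "y \<in> carrier H"
      then have "N #>\<^bsub>G\<^esub> s y \<in> carrier (G Mod N)"
        using hom_in_carrier[OF s] by (auto simp: carrier_FactGroup)
      then show "y \<in> (\<lambda>C. the_elem (h ` C)) ` carrier (G Mod N)"
        using section_value[OF y] by force
    qed
  qed
  moreover have "(\<lambda>C. C) ` carrier (K Mod N) = kernel (G Mod N) H (\<lambda>C. the_elem (h ` C))"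
  proof
    show "(\<lambda>C. C) ` carrier (K Mod N) \<subseteq> kernel (G Mod N) H (\<lambda>C. the_elem (h ` C))"
      unfolding carrier_KN by (auto simp: kernel_def carrier_FactGroup coset_value)
    show "kernel (G Mod N) H (\<lambda>C. the_elem (h ` C)) \<subseteq> (\<lambda>C. C) ` carrier (K Mod N)"
      unfolding carrier_KN by (auto simp: kernel_def carrier_FactGroup coset_value)
  qed
  ultimately show "split_extension (K Mod N) (\<lambda>C. C) (G Mod N) (\<lambda>C. the_elem (h ` C)) H"
    unfolding split_extension_def epi_def
    using KN.is_group N.factorgroup_is_group H
    by (intro conjI bexI[of _ "\<lambda>y. N #>\<^bsub>G\<^esub> s y"] CollectI ballI) simp_all
qed

lemma (in group) normal_Inter:
  assumes "\<And>H. H \<in> A \<Longrightarrow> H \<lhd> G" "A \<noteq> {}"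
  shows "\<Inter>A \<lhd> G"
proof -
  have "subgroup (\<Inter>A) G"
    using assms by (intro subgroups_Inter) (auto intro: normal_imp_subgroup)
  moreover have "\<forall>x\<in>carrier G. \<forall>h\<in>\<Inter>A. x \<otimes> h \<otimes> inv x \<in> \<Inter>A"
    using assms(1) by (auto simp: normal_inv_iff)
  ultimately show ?thesis
    by (simp add: normal_inv_iff)
qed

lemma (in group) normal_closure_normal:
  assumes "S \<subseteq> carrier G"
  shows "normal_closure G S \<lhd> G"
proof -
  have "carrier G \<lhd> G"
    by (simp add: normal_inv_iff subgroup_self)
  then show ?thesis
    unfolding normal_closure_def using assms by (intro normal_Inter) auto
qed

lemma normal_closure_subset:
  assumes "H \<lhd> G" "S \<subseteq> H"
  shows "normal_closure G S \<subseteq> H"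
  using assms by (auto simp: normal_closure_def)

section \<open>Braid groups and pure braid groups\<close>

abbreviation braid_class :: "nat \<Rightarrow> braid_word \<Rightarrow> braid_word set"
  where "braid_class n w \<equiv> braid_rel n `` {w}"

lemma braid_words_append [simp]:
  "v @ w \<in> braid_words n \<longleftrightarrow> v \<in> braid_words n \<and> w \<in> braid_words n"
  by (auto simp: braid_words_def)

lemma braid_words_Cons [simp]:
  "(i, b) # w \<in> braid_words n \<longleftrightarrow> 1 \<le> i \<and> i < n \<and> w \<in> braid_words n"
  by (auto simp: braid_words_def)

lemma braid_words_Nil [simp]: "[] \<in> braid_words n"
  by (auto simp: braid_words_def)

lemma braid_perm_append: "braid_perm (v @ w) = braid_perm v \<circ> braid_perm w"
  by (induction v rule: braid_perm.induct) (auto simp: comp_assoc)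

lemma braid_perm_permutes: "w \<in> braid_words n \<Longrightarrow> braid_perm w permutes {1..n}"
proof (induction w rule: braid_perm.induct)
  case (2 i b w)
  then have "transpose i (i + 1) permutes {1..n}"
    by (intro permutes_swap_id) auto
  moreover have "braid_perm w permutes {1..n}"
    using 2 by simp
  ultimately show ?case
    unfolding braid_perm.simps by (intro permutes_compose)
qed (simp add: permutes_id)

lemma braid_eq_words: "braid_eq n v w \<Longrightarrow> v \<in> braid_words n \<and> w \<in> braid_words n"
  by (induction rule: braid_eq.induct) auto

lemma braid_eq_perm: "braid_eq n v w \<Longrightarrow> braid_perm v = braid_perm w"
proof (induction rule: braid_eq.induct)
  case (far i j)
  then show ?case by (auto simp: fun_eq_iff transpose_def)
next
  case (braid i)
  then show ?case by (auto simp: fun_eq_iff transpose_def)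
qed (auto simp: braid_perm_append)

lemma braid_eq_append:
  assumes "braid_eq n v v'" "braid_eq n w w'"
  shows "braid_eq n (v @ w) (v' @ w')"
proof -
  have "braid_eq n ([] @ v @ w) ([] @ v' @ w)"
    using assms by (intro braid_eq.cong) (auto dest: braid_eq_words)
  moreover have "braid_eq n (v' @ w @ []) (v' @ w' @ [])"
    using assms by (intro braid_eq.cong) (auto dest: braid_eq_words)
  ultimately show ?thesis
    by (auto intro: braid_eq.trans)
qed

lemma equiv_braid_rel: "equiv (braid_words n) (braid_rel n)"
proof (rule equivI)
  show "braid_rel n \<subseteq> braid_words n \<times> braid_words n"
    by (auto simp: braid_rel_def dest: braid_eq_words)
  show "refl_on (braid_words n) (braid_rel n)"
    by (auto simp: braid_rel_def refl_on_def intro: braid_eq.refl)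
  show "sym (braid_rel n)"
    by (auto simp: braid_rel_def sym_def intro: braid_eq.sym)
  show "trans (braid_rel n)"
    by (auto simp: braid_rel_def trans_def intro: braid_eq.trans)
qed

lemma braid_class_eq: "braid_eq n v w \<Longrightarrow> braid_class n v = braid_class n w"
  using equiv_class_eq[OF equiv_braid_rel] by (auto simp: braid_rel_def)

lemma in_braid_class_iff: "v \<in> braid_class n w \<longleftrightarrow> braid_eq n w v"
  by (simp add: braid_rel_def)

lemma braid_class_image:
  assumes "w \<in> braid_words n" "\<And>v. braid_eq n w v \<Longrightarrow> f v = f w"
  shows "f ` braid_class n w = {f w}"
proof -
  have "w \<in> braid_class n w"
    using assms(1) by (simp add: braid_rel_def braid_eq.refl)
  moreover have "f ` braid_class n w = (\<lambda>v. f w) ` braid_class n w"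
    using assms(2) in_braid_class_iff by (intro image_cong) blast+
  ultimately show ?thesis by blast
qed

lemma braid_class_UN:
  assumes "w \<in> braid_words n" "\<And>v. braid_eq n w v \<Longrightarrow> F v = F w"
  shows "(\<Union>v \<in> braid_class n w. F v) = F w"
  using braid_class_image[of w n F, OF assms] by simp

lemma carrier_braid_group: "carrier (braid_group n) = braid_class n ` braid_words n"
  by (auto simp: braid_group_def quotient_def)

lemma one_braid_group: "\<one>\<^bsub>braid_group n\<^esub> = braid_class n []"
  by (simp add: braid_group_def)

lemma mult_braid_class:
  assumes "v \<in> braid_words n" "w \<in> braid_words n"
  shows "braid_class n v \<otimes>\<^bsub>braid_group n\<^esub> braid_class n w = braid_class n (v @ w)"
proof -
  let ?U = "{v' @ w' | v' w'. v' \<in> braid_class n v \<and> w' \<in> braid_class n w}"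
  have "braid_class n u = braid_class n (v @ w)" if "u \<in> ?U" for u
  proof -
    from that obtain v' w' where "u = v' @ w'" "braid_eq n v v'" "braid_eq n w w'"
      by (auto simp: braid_rel_def)
    then show ?thesis
      using braid_class_eq[OF braid_eq_append] by blast
  qed
  moreover have "v @ w \<in> ?U"
    using assms by (auto simp: braid_rel_def intro: braid_eq.refl)
  moreover have "braid_rel n `` ?U = (\<Union>u \<in> ?U. braid_class n u)"
    by blast
  ultimately have "braid_rel n `` ?U = braid_class n (v @ w)"
    by (metis (no_types, lifting) SUP_eq_const empty_iff)
  then show ?thesis
    by (simp only: braid_group_def monoid.simps)
qed

definition inverse_word :: "braid_word \<Rightarrow> braid_word"
  where "inverse_word w = rev (map (\<lambda>(i, b). (i, \<not> b)) w)"

lemma inverse_word_words: "w \<in> braid_words n \<Longrightarrow> inverse_word w \<in> braid_words n"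
  by (auto simp: inverse_word_def braid_words_def lists_eq_set)

lemma inverse_word_cancel:
  "w \<in> braid_words n \<Longrightarrow> braid_eq n (inverse_word w @ w) []"
proof (induction w)
  case Nil
  then show ?case by (simp add: inverse_word_def braid_eq.refl)
next
  case (Cons l w)
  obtain i b where l: "l = (i, b)" by (cases l)
  with Cons have w: "w \<in> braid_words n" "1 \<le> i" "i < n" by auto
  have "braid_eq n (inverse_word w @ [(i, \<not> b), (i, b)] @ w) (inverse_word w @ [] @ w)"
    using w braid_eq.cancel[of i n "\<not> b"]
    by (intro braid_eq.cong) (auto simp: inverse_word_words)
  then have "braid_eq n (inverse_word w @ [(i, \<not> b), (i, b)] @ w) []"
    using Cons.IH[OF w(1)] by (auto intro: braid_eq.trans)
  then show ?case by (simp add: l inverse_word_def)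
qed

lemma group_braid_group: "group (braid_group n)"
proof (rule groupI)
  fix A assume "A \<in> carrier (braid_group n)"
  then obtain w where w: "w \<in> braid_words n" "A = braid_class n w"
    by (auto simp: carrier_braid_group)
  then show "\<exists>B \<in> carrier (braid_group n). B \<otimes>\<^bsub>braid_group n\<^esub> A = \<one>\<^bsub>braid_group n\<^esub>"
    using braid_class_eq[OF inverse_word_cancel[OF w(1)]] inverse_word_words[OF w(1)]
    by (auto simp: carrier_braid_group mult_braid_class one_braid_group
        intro!: bexI[of _ "braid_class n (inverse_word w)"])
qed (auto simp: carrier_braid_group one_braid_group mult_braid_class)

lemma the_elem_braid_perm:
  "w \<in> braid_words n \<Longrightarrow> the_elem (braid_perm ` braid_class n w) = braid_perm w"
  by (subst braid_class_image) (auto dest: braid_eq_perm)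

lemma braid_perm_hom:
  "(\<lambda>A. the_elem (braid_perm ` A)) \<in> hom (braid_group n) (sym_group n)"
  by (rule homI)
    (auto simp: carrier_braid_group mult_braid_class the_elem_braid_perm braid_perm_append
      sym_group_def braid_perm_permutes[simplified])

lemma carrier_pure_braid_group:
  "carrier (pure_braid_group n) = braid_class n ` {w \<in> braid_words n. braid_perm w = id}"
  by (auto simp: pure_braid_group_def kernel_def carrier_braid_group the_elem_braid_perm
      sym_group_def)

lemma one_pure_braid_group: "\<one>\<^bsub>pure_braid_group n\<^esub> = braid_class n []"
  by (simp add: pure_braid_group_def one_braid_group)

lemma mult_pure_braid_group:
  assumes "v \<in> braid_words n" "w \<in> braid_words n"
  shows "braid_class n v \<otimes>\<^bsub>pure_braid_group n\<^esub> braid_class n w = braid_class n (v @ w)"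
  using mult_braid_class[OF assms] by (simp add: pure_braid_group_def)

lemma group_pure_braid_group: "group (pure_braid_group n)"
proof -
  interpret group_hom "braid_group n" "sym_group n" "\<lambda>A. the_elem (braid_perm ` A)"
    by (intro group_hom.intro group_hom_axioms.intro group_braid_group sym_group_is_group
        braid_perm_hom)
  show ?thesis
    unfolding pure_braid_group_def by (rule group.subgroup_imp_group[OF group_braid_group subgroup_kernel])
qed

section \<open>Ranks of surviving strands\<close>

definition rank :: "nat \<Rightarrow> (nat \<Rightarrow> nat) \<Rightarrow> nat \<Rightarrow> nat"
  where "rank m p i = card {k \<in> {1..i}. p k \<le> m}"

lemma rank_0 [simp]: "rank m p 0 = 0"
  by (simp add: rank_def)

lemma rank_Suc [simp]: "rank m p (Suc i) = rank m p i + (if p (Suc i) \<le> m then 1 else 0)"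
proof -
  have "{k \<in> {1..Suc i}. p k \<le> m}
      = (if p (Suc i) \<le> m then insert (Suc i) {k \<in> {1..i}. p k \<le> m} else {k \<in> {1..i}. p k \<le> m})"
    by (auto simp: le_Suc_eq)
  then show ?thesis by (simp add: rank_def)
qed

lemma rank_mono: "i \<le> j \<Longrightarrow> rank m p i \<le> rank m p j"
  by (induction rule: dec_induct) auto

lemma rank_less:
  assumes "i < j" "p j \<le> m"
  shows "rank m p i < rank m p j"
proof -
  obtain j' where j': "j = Suc j'" using assms by (cases j) auto
  with assms have "rank m p i \<le> rank m p j'" by (intro rank_mono) auto
  with assms j' show ?thesis by simp
qed

lemma rank_transpose_less:
  "i < j \<Longrightarrow> rank m (p \<circ> transpose j (Suc j)) i = rank m p i"
  by (induction i) auto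

text \<open>
  Exchanging the strands in positions \<open>j\<close> and \<open>j + 1\<close> is noticed only by the initial segment that
  separates these positions.
\<close>

lemma rank_transpose:
  assumes "1 \<le> j" "i \<noteq> j"
  shows "rank m (p \<circ> transpose j (Suc j)) i = rank m p i"
proof (cases "i < j")
  case False
  with assms have "Suc j \<le> i" by simp
  then show ?thesis
  proof (induction rule: dec_induct)
    case base
    obtain j' where "j = Suc j'" using assms by (cases j) auto
    then show ?case using rank_transpose_less[of j' j m p] by (simp add: comp_def)
  qed auto
qed (rule rank_transpose_less)

lemma rank_le:
  assumes "p permutes {1..n}" "i \<le> n"
  shows "rank m p i \<le> m"
proof -
  have "card {k \<in> {1..i}. p k \<le> m} \<le> card {1..m}"
  proof (rule card_inj_on_le)
    show "inj_on p {k \<in> {1..i}. p k \<le> m}"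
      using permutes_inj_on[OF assms(1)] by blast
    have "1 \<le> p k" if "1 \<le> k" "k \<le> i" for k
      using permutes_in_image[OF assms(1), of k] that assms(2) by auto
    then show "p ` {k \<in> {1..i}. p k \<le> m} \<subseteq> {1..m}" by auto
  qed simp
  then show ?thesis by (simp add: rank_def)
qed

lemma rank_permutes_id:
  assumes "p permutes {1..m}"
  shows "i \<le> m \<Longrightarrow> rank m p i = i"
proof (induction i)
  case (Suc i)
  then have "p (Suc i) \<le> m"
    using permutes_in_image[OF assms, of "Suc i"] by auto
  with Suc show ?case by simp
qed simp

section \<open>Erasing strands from braid diagrams\<close>

lemma forget_word_Cons:
  "forget_word m p ((i, b) # w) =
    (if p i \<le> m \<and> p (Suc i) \<le> m then [(rank m p i, b)] else [])
    @ forget_word m (p \<circ> transpose i (Suc i)) w"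
  by (simp add: rank_def)

declare forget_word.simps(2) [simp del]
declare forget_word_Cons [simp]

lemma forget_word_append:
  "forget_word m p (v @ w) = forget_word m p v @ forget_word m (p \<circ> braid_perm v) w"
proof (induction v arbitrary: p)
  case (Cons l v)
  then show ?case by (cases l) (simp add: comp_def)
qed simp

lemma forget_word_words:
  "w \<in> braid_words n \<Longrightarrow> p permutes {1..n} \<Longrightarrow> forget_word m p w \<in> braid_words m"
proof (induction w arbitrary: p)
  case (Cons l w)
  obtain i b where l: "l = (i, b)" by (cases l)
  with Cons.prems have i: "1 \<le> i" "i < n" "w \<in> braid_words n" by auto
  have "transpose i (Suc i) permutes {1..n}"
    using i by (intro permutes_swap_id) auto
  then have "forget_word m (p \<circ> transpose i (Suc i)) w \<in> braid_words m"
    using Cons i by (intro Cons.IH permutes_compose) auto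
  moreover have "1 \<le> rank m p i \<and> rank m p i < m" if "p i \<le> m" "p (Suc i) \<le> m"
    using rank_less[of 0 i p m] rank_less[of i "Suc i" p m] rank_le[of p n "Suc i" m] that i Cons.prems
    by auto
  ultimately show ?case by (simp add: l)
qed simp

text \<open>
  In the diagrams of the two sides of an Artin relation the same pairs of strands cross. If all
  strands of the relation survive, erasing the others shifts the indices and leaves the relation
  intact. If only two strands of the braid relation survive, both sides become their single
  crossing, with the same index.
\<close>

lemma forget_word_eq:
  "braid_eq n v w \<Longrightarrow> p permutes {1..n}
    \<Longrightarrow> braid_eq m (forget_word m p v) (forget_word m p w)"
proof (induction arbitrary: p rule: braid_eq.induct)
  case (refl w)
  then show ?case by (simp add: braid_eq.refl forget_word_words)
next
  case (sym v w)
  then show ?case by (simp add: braid_eq.sym)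
next
  case (trans u v w)
  then show ?case by (blast intro: braid_eq.trans)
next
  case (cong x y v w)
  have perm: "braid_perm v = braid_perm w"
    using cong.hyps by (simp add: braid_eq_perm)
  have px: "p \<circ> braid_perm x permutes {1..n}"
    using cong by (intro permutes_compose braid_perm_permutes)
  have "w \<in> braid_words n"
    using cong.hyps by (blast dest: braid_eq_words)
  then have pxw: "p \<circ> braid_perm x \<circ> braid_perm w permutes {1..n}"
    by (intro permutes_compose[OF braid_perm_permutes px])
  show ?case
    unfolding forget_word_append perm
    by (intro braid_eq.cong forget_word_words cong.IH) (fact cong px pxw)+
next
  case (cancel i b)
  have word: "forget_word m p [(i, b), (i, \<not> b)] \<in> braid_words m"
    using cancel by (intro forget_word_words) auto
  \<comment> \<open>Crossings at \<open>i\<close> leave the ranks up to \<open>i - 1\<close> alone, so all indices are counted from there.\<close>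
  obtain j where j: "i = Suc j" using cancel by (cases i) auto
  show ?case
    using word rank_transpose_less[of j "Suc j" m p]
    by (auto simp: j braid_eq.refl intro!: braid_eq.cancel)
next
  case (far i j)
  have word: "forget_word m p [(i, True), (j, True)] \<in> braid_words m"
    using far by (intro forget_word_words) auto
  have fixed: "transpose i (Suc i) j = j" "transpose i (Suc i) (Suc j) = Suc j"
    "transpose j (Suc j) i = i" "transpose j (Suc j) (Suc i) = Suc i"
    using far by (auto simp: transpose_def)
  have ranks: "rank m (p \<circ> transpose i (Suc i)) j = rank m p j"
    "rank m (p \<circ> transpose j (Suc j)) i = rank m p i"
    using far by (auto intro!: rank_transpose)
  have "rank m p i + 1 < rank m p j" if "p (Suc i) \<le> m" "p j \<le> m"
    using rank_less[of "Suc i" j p m] that far by simp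
  then show ?case
    using word by (auto simp: fixed ranks braid_eq.refl intro!: braid_eq.far)
next
  case (braid i)
  have word: "forget_word m p [(i, True), (i + 1, True), (i, True)] \<in> braid_words m"
    "forget_word m p [(i + 1, True), (i, True), (i + 1, True)] \<in> braid_words m"
    using braid by (intro forget_word_words; simp)+
  obtain j where j: "i = Suc j" using braid by (cases i) auto
  have ranks: "rank m (q \<circ> transpose (Suc j) (Suc (Suc j))) j = rank m q j"
    "rank m (q \<circ> transpose (Suc (Suc j)) (Suc (Suc (Suc j)))) j = rank m q j" for q
    by (auto intro!: rank_transpose_less)
  show ?case
    using word braid_eq.braid[of "Suc (rank m p j)" m]
    by (auto simp: j ranks transpose_def braid_eq.refl split: if_splits)
qed

text \<open>
  After \<open>w\<close>, the strand in position \<open>k\<close> is one that was in position \<open>braid_perm w k\<close> before;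
  in the erased diagram these positions are replaced by their ranks.
\<close>

lemma braid_perm_forget_word:
  assumes "w \<in> braid_words n" "p permutes {1..n}"
    and "k \<in> {1..n}" "p (braid_perm w k) \<le> m"
  shows "braid_perm (forget_word m p w) (rank m (p \<circ> braid_perm w) k) = rank m p (braid_perm w k)"
  using assms(1,2,4)
proof (induction w arbitrary: p)
  case (Cons l w)
  obtain i b where l: "l = (i, b)" by (cases l)
  define t where "t = transpose i (Suc i)"
  define x where "x = braid_perm w k"
  have i: "1 \<le> i" "i < n" "w \<in> braid_words n" using Cons.prems l by auto
  have x: "1 \<le> x"
    using permutes_in_image[OF braid_perm_permutes[OF i(3)], of k] assms(3) by (auto simp: x_def)
  have "t permutes {1..n}"
    unfolding t_def using i by (intro permutes_swap_id) auto
  then have "p \<circ> t permutes {1..n}"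
    using Cons.prems by (intro permutes_compose)
  moreover have pt: "p (t x) \<le> m"
    using Cons.prems by (simp add: l x_def t_def)
  ultimately have IH: "braid_perm (forget_word m (p \<circ> t) w) (rank m (p \<circ> t \<circ> braid_perm w) k)
      = rank m (p \<circ> t) x"
    using Cons.IH[OF i(3), of "p \<circ> t"] by (simp add: x_def comp_def)
  obtain j where j: "i = Suc j" using i by (cases i) auto
  let ?c = "rank m p i"
  \<comment> \<open>This is the effect of the first letter alone: its surviving crossing, if any, exchanges the ranks
    \<open>?c\<close> and \<open>?c + 1\<close>, and no other surviving strand has one of these ranks.\<close>
  have "(if p i \<le> m \<and> p (Suc i) \<le> m then transpose ?c (Suc ?c) else id) (rank m (p \<circ> t) x)
      = rank m p (t x)"
  proof -
    consider "x = i" | "x = Suc i" | "x < i" | "Suc i < x" by linarith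
    then show ?thesis
    proof cases
      case 1
      then show ?thesis
        using pt rank_transpose_less[of j i m p] by (auto simp: t_def j)
    next
      case 2
      then show ?thesis
        using pt rank_transpose_less[of j i m p] by (auto simp: t_def j)
    next
      case 3
      then have "t x = x" by (auto simp: t_def transpose_def)
      moreover have "rank m p x < ?c" if "p i \<le> m"
        using rank_less[of x i p m] 3 that by simp
      ultimately show ?thesis
        using 3 i rank_transpose[of i x m p] by (auto simp: t_def transpose_def)
    next
      case 4
      then have "t x = x" by (auto simp: t_def transpose_def)
      moreover have "Suc ?c < rank m p x" if "p (Suc i) \<le> m"
        using rank_less[of "Suc i" x p m] 4 that pt \<open>t x = x\<close> by simp
      ultimately show ?thesis
        using 4 i rank_transpose[of i x m p] by (auto simp: t_def transpose_def)
    qed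
  qed
  with IH show ?case
    by (auto simp: l x_def t_def comp_def split: if_splits)
qed simp

lemma forget_word_pure:
  assumes "m \<le> n" "w \<in> braid_words n" "braid_perm w = id"
  shows "braid_perm (forget_word m id w) = id"
proof
  fix k
  have rank_id: "rank m id k = k" if "k \<le> m" for k
    using rank_permutes_id[OF permutes_id that] .
  have perm: "braid_perm (forget_word m id w) permutes {1..m}"
    using assms by (intro braid_perm_permutes forget_word_words[of _ n]) (auto simp: permutes_id)
  show "braid_perm (forget_word m id w) k = id k"
  proof (cases "k \<in> {1..m}")
    case True
    then show ?thesis
      using braid_perm_forget_word[OF assms(2) permutes_id, of k m] assms rank_id[of k] by auto
  next
    case False
    then show ?thesis using permutes_not_in[OF perm] by auto
  qed
qed

section \<open>The forgetful homomorphism and its section\<close>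

lemma forget_braid_class:
  assumes "w \<in> braid_words n"
  shows "forget m (braid_class n w) = braid_class m (forget_word m id w)"
proof -
  have "braid_class m (forget_word m id v) = braid_class m (forget_word m id w)"
    if "braid_eq n w v" for v
    using braid_class_eq[OF forget_word_eq[OF that permutes_id]] by simp
  moreover have "forget m (braid_class n w)
      = (\<Union>v \<in> braid_class n w. braid_class m (forget_word m id v))"
    unfolding forget_def by blast
  ultimately show ?thesis
    using braid_class_UN[OF assms, of "\<lambda>v. braid_class m (forget_word m id v)"] by simp
qed

lemma forget_hom:
  assumes "m \<le> n"
  shows "forget m \<in> hom (pure_braid_group n) (pure_braid_group m)"
proof (rule homI)
  fix A assume "A \<in> carrier (pure_braid_group n)"
  then obtain v where v: "v \<in> braid_words n" "braid_perm v = id" "A = braid_class n v"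
    by (auto simp: carrier_pure_braid_group)
  then have fv: "forget_word m id v \<in> braid_words m"
    by (auto intro: forget_word_words permutes_id)
  then show "forget m A \<in> carrier (pure_braid_group m)"
    using v forget_word_pure[OF assms v(1,2)]
    by (auto simp: forget_braid_class carrier_pure_braid_group)
  fix B assume "B \<in> carrier (pure_braid_group n)"
  then obtain w where w: "w \<in> braid_words n" "braid_perm w = id" "B = braid_class n w"
    by (auto simp: carrier_pure_braid_group)
  then have "forget_word m id w \<in> braid_words m"
    by (auto intro: forget_word_words permutes_id)
  with v w fv show "forget m (A \<otimes>\<^bsub>pure_braid_group n\<^esub> B)
      = forget m A \<otimes>\<^bsub>pure_braid_group m\<^esub> forget m B"
    by (simp add: mult_pure_braid_group forget_braid_class forget_word_append)
qed

text \<open>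
  All words on \<open>m\<close> strands in \<open>A\<close> represent one braid on \<open>n\<close> strands; its class may also
  contain words that use the additional generators.
\<close>

definition include_braid :: "nat \<Rightarrow> braid_word set \<Rightarrow> braid_word set"
  where "include_braid n A = braid_rel n `` A"

lemma braid_words_mono: "m \<le> n \<Longrightarrow> w \<in> braid_words m \<Longrightarrow> w \<in> braid_words n"
  by (auto simp: braid_words_def)

lemma braid_eq_mono: "braid_eq m v w \<Longrightarrow> m \<le> n \<Longrightarrow> braid_eq n v w"
proof (induction rule: braid_eq.induct)
  case (trans u v w)
  then show ?case by (blast intro: braid_eq.trans)
next
  case (braid i)
  then show ?case by (intro braid_eq.braid) auto
qed (auto intro: braid_eq.intros braid_words_mono)

lemma include_braid_class:
  assumes "m \<le> n" "w \<in> braid_words m"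
  shows "include_braid n (braid_class m w) = braid_class n w"
proof -
  have "braid_class n v = braid_class n w" if "braid_eq m w v" for v
    using braid_class_eq[OF braid_eq_mono[OF that assms(1)]] by simp
  moreover have "include_braid n (braid_class m w) = (\<Union>v \<in> braid_class m w. braid_class n v)"
    unfolding include_braid_def by blast
  ultimately show ?thesis
    using braid_class_UN[OF assms(2), of "braid_class n"] by simp
qed

lemma include_braid_hom:
  assumes "m \<le> n"
  shows "include_braid n \<in> hom (pure_braid_group m) (pure_braid_group n)"
  by (rule homI)
    (auto simp: carrier_pure_braid_group include_braid_class[OF assms] mult_pure_braid_group
      braid_words_mono[OF assms])

lemma forget_word_id:
  "w \<in> braid_words m \<Longrightarrow> p permutes {1..m} \<Longrightarrow> forget_word m p w = w"
proof (induction w arbitrary: p)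
  case (Cons l w)
  obtain i b where l: "l = (i, b)" by (cases l)
  with Cons.prems have i: "1 \<le> i" "i < m" "w \<in> braid_words m" by auto
  have "transpose i (Suc i) permutes {1..m}"
    using i by (intro permutes_swap_id) auto
  then have "forget_word m (p \<circ> transpose i (Suc i)) w = w"
    using Cons i by (intro Cons.IH permutes_compose) auto
  moreover have "p i \<le> m" "p (Suc i) \<le> m"
    using permutes_in_image[OF Cons.prems(2), of i] permutes_in_image[OF Cons.prems(2), of "Suc i"] i
    by auto
  ultimately show ?case
    using rank_permutes_id[OF Cons.prems(2), of i] i by (simp add: l)
qed simp

lemma forget_include:
  assumes "m \<le> n" "A \<in> carrier (pure_braid_group m)"
  shows "forget m (include_braid n A) = A"
  using assms
  by (auto simp: carrier_pure_braid_group include_braid_class forget_braid_class braid_words_mono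
      forget_word_id permutes_id)

section \<open>Pure braid generators and forgetting\<close>

definition pure_gen_word :: "nat \<Rightarrow> nat \<Rightarrow> braid_word"
  where "pure_gen_word i j =
    map (\<lambda>k. (k, True)) (rev [i + 1..<j]) @ [(i, True), (i, True)] @ map (\<lambda>k. (k, False)) [i + 1..<j]"

lemma pure_gen_word_adjacent: "pure_gen_word i (Suc i) = [(i, True), (i, True)]"
  by (simp add: pure_gen_word_def)

lemma pure_gen_word_Suc:
  "i < j \<Longrightarrow> pure_gen_word i (Suc j) = (j, True) # pure_gen_word i j @ [(j, False)]"
  by (simp add: pure_gen_word_def)

lemma pure_gen_word_words:
  "1 \<le> i \<Longrightarrow> j \<le> n \<Longrightarrow> i < j \<Longrightarrow> pure_gen_word i j \<in> braid_words n"
  by (auto simp: pure_gen_word_def braid_words_def)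

lemma braid_perm_pure_gen_word:
  assumes "i < j"
  shows "braid_perm (pure_gen_word i j) = id"
  using Suc_leI[OF assms]
proof (induction j rule: dec_induct)
  case base
  then show ?case by (simp add: pure_gen_word_adjacent)
next
  case (step j)
  then show ?case by (simp add: pure_gen_word_Suc braid_perm_append)
qed

text \<open>
  The strand that starts in position \<open>j\<close> takes part in every crossing of \<open>pure_gen_word i j\<close>. The
  induction moves it one position to the left, so the labelling \<open>p\<close> has to vary.
\<close>

lemma forget_pure_gen_word:
  assumes "i < j" "m < p j"
  shows "forget_word m p (pure_gen_word i j) = []"
  using Suc_leI[OF assms(1)] assms(2)
proof (induction j arbitrary: p rule: dec_induct)
  case base
  then show ?case by (simp add: pure_gen_word_adjacent)
next
  case (step j)
  then have "forget_word m (p \<circ> transpose j (Suc j)) (pure_gen_word i j) = []"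
    by (intro step.IH) simp
  with step show ?case
    by (simp add: pure_gen_word_Suc forget_word_append braid_perm_pure_gen_word)
qed

lemma pure_gen_eq: "pure_gen n i j = braid_class n (pure_gen_word i j)"
  by (simp add: pure_gen_def pure_gen_word_def)

lemma pure_gen_carrier:
  "1 \<le> i \<Longrightarrow> i < j \<Longrightarrow> j \<le> n \<Longrightarrow> pure_gen n i j \<in> carrier (pure_braid_group n)"
  by (auto simp: pure_gen_eq carrier_pure_braid_group pure_gen_word_words braid_perm_pure_gen_word)

lemma forget_pure_gen:
  assumes "1 \<le> i" "i < j" "j \<le> n" "m < j"
  shows "forget m (pure_gen n i j) = \<one>\<^bsub>pure_braid_group m\<^esub>"
  using assms
  by (simp add: pure_gen_eq forget_braid_class pure_gen_word_words forget_pure_gen_word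
      one_pure_braid_group)

section \<open>Graphic pure braid groups\<close>

text \<open>
  A non-edge \<open>{i, j}\<close> with \<open>i < j\<close> has \<open>j > m\<close>, since both ends would otherwise lie in the clique.
\<close>

lemma nonedge_generators:
  assumes "[{1..m}]\<^bsup>2\<^esup> \<subseteq> E" and "m \<le> n"
  shows "{pure_gen n i j | i j. i < j \<and> {i, j} \<in> [{1..n}]\<^bsup>2\<^esup> - E}
    \<subseteq> kernel (pure_braid_group n) (pure_braid_group m) (forget m)"
proof clarify
  fix i j assume ij: "i < j" "{i, j} \<in> [{1..n}]\<^bsup>2\<^esup>" "{i, j} \<notin> E"
  then have "1 \<le> i" "j \<le> n" by (auto simp: nsets_def)
  moreover have "m < j"
  proof (rule ccontr)
    assume "\<not> m < j"
    with ij \<open>1 \<le> i\<close> have "{i, j} \<in> [{1..m}]\<^bsup>2\<^esup>" by (auto simp: nsets_def)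
    with ij assms(1) show False by blast
  qed
  ultimately show "pure_gen n i j \<in> kernel (pure_braid_group n) (pure_braid_group m) (forget m)"
    using ij(1) by (simp add: kernel_def pure_gen_carrier forget_pure_gen)
qed

theorem theorem4p2:
  fixes n m :: nat and E :: "nat set set"
  assumes "E \<subseteq> [{1..n}]\<^bsup>2\<^esup>"
    and "m \<le> n"
    and "[{1..m}]\<^bsup>2\<^esup> \<subseteq> E"
  shows "graphic_relators n E \<lhd> pure_braid_forget_kernel n m \<and>
    split_extension
      (pure_braid_forget_kernel n m Mod graphic_relators n E)
      (\<lambda>C. C)
      (graphic_pure_braid_group n E)
      (\<lambda>C. the_elem (forget m ` C))
      (pure_braid_group m)"
proof -
  interpret Pn: group "pure_braid_group n" by (rule group_pure_braid_group)
  interpret group_hom "pure_braid_group n" "pure_braid_group m" "forget m"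
    by (intro group_hom.intro group_hom_axioms.intro group_pure_braid_group forget_hom assms)
  have generators: "{pure_gen n i j | i j. i < j \<and> {i, j} \<in> [{1..n}]\<^bsup>2\<^esup> - E}
      \<subseteq> kernel (pure_braid_group n) (pure_braid_group m) (forget m)"
    using assms by (intro nonedge_generators)
  then have "graphic_relators n E \<lhd> pure_braid_group n"
    unfolding graphic_relators_def by (intro Pn.normal_closure_normal) (auto simp: kernel_def)
  moreover have "graphic_relators n E \<subseteq> kernel (pure_braid_group n) (pure_braid_group m) (forget m)"
    unfolding graphic_relators_def by (intro normal_closure_subset normal_kernel generators)
  ultimately show ?thesis
    unfolding pure_braid_forget_kernel_def graphic_pure_braid_group_def
    using split_extension_quotient[OF group_pure_braid_group group_pure_braid_group
        forget_hom[OF assms(2)] include_braid_hom[OF assms(2)] forget_include[OF assms(2)]]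
    by blast
qed

end
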